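(* The triple $\check{\mathbb G}=(\check G,\check\eta_G,\check\mu_G)$ is a monad in the category of Tychonoff spaces and continuous maps. Here for a Tychonoff space $X$, $\check GX$ is the space of all compact inclusion hyperspaces in $X$; for a continuous map $f:X\to Y$ of Tychonoff spaces, $\check Gf(\mathcal F)=\{B\subset Y \text{ closed}\mid B\supset f(F)\text{ for some }F\in\mathcal F\}$, $\mathcal F\in\check GX$; and the unit and multiplication are given by $$\check\eta_GX(x)=\{F\in\exp X\mid x\in F\},\quad x\in X,$$ $$\check\mu_GX(\mathbf F)=\Big\{F\in\exp X\;\Big|\; F\in\bigcap \mathrm H\text{ for some }\mathrm H\in\mathbf F\Big\},\quad \mathbf F\in\check G(\check GX).$$
   Context: A Tychonoff space is a completely regular Hausdorff space; a compactum is a compact Hausdorff space. For a Tychonoff space $X$, $\exp X$ denotes the set of all non-empty closed subsets of $X$. The lower topology on $\exp X$ has the subbase of all sets $\{F\in\exp X\mid F\cap U\neq\varnothing\}$, $U\subset X$ open. A compact inclusion hyperspace in a Tychonoff space $X$ is a non-empty collection $\mathcal F\subset\exp X$ such that $A\subset B$, $A\in\mathcal F$, $B$ closed in $X$ imply $B\in\mathcal F$, and $\mathcal F$ is compact in the lower topology on $\exp X$. The set of all of them is $\check GX$. For a compactum $K$, an inclusion hyperspace on $K$ is a non-empty subset $\mathcal F\subset\exp K$, closed in the Vietoris topology, such that $A\subset B\in\exp K$, $A\in\mathcal F$ imply $B\in\mathcal F$. The set $GK$ of all inclusion hyperspaces on $K$ (which equals $\check GK$) carries the compact Hausdorff topology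 with the subbase of all sets $U^+=\{\mathcal F\in GK\mid \exists F\in\mathcal F,\ F\subset U\}$ and $U^-=\{\mathcal F\in GK\mid F\cap U\ne\varnothing\text{ for all }F\in\mathcal F\}$, $U\subset K$ open. For Tychonoff $X$ with Stone–Čech compactification $\beta X\supset X$, the map $e_GX:\check GX\to G\beta X$, $e_GX(\mathcal F)=\{A\in\exp\beta X\mid A\cap X\in\mathcal F\}$, is injective, and $\check GX$ is given the topology making $e_GX$ a topological embedding; $\check GX$ is then Tychonoff, so $\check G$ can be applied to it. In the formula for $\check\mu_GX$, each $\mathrm H\in\mathbf F$ is a non-empty closed subset of the space $\check GX$, and $\bigcap\mathrm H$ is the intersection of the collections belonging to $\mathrm H$. A monad in a category $\mathcal C$ is a triple $(F,\eta,\mu)$ with $F:\mathcal C\to\mathcal C$ a functor and $\eta:\mathbf 1_{\mathcal C}\to F$, $\mu:F^2\to F$ natural transformations such that $\mu X\circ\eta FX=\mu X\circ F\eta X=\mathbf 1_{FX}$ and $\mu X\circ F\mu X=\mu X\circ\mu FX$ for all objects $X$. *)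

theory Defs
  imports "HOL-Analysis.Analysis"
begin

definition tychonoff_space :: "'a topology \<Rightarrow> bool" where
  "tychonoff_space X \<longleftrightarrow> completely_regular_space X \<and> Hausdorff_space X"


section \<open>Hyperspaces\<close>

definition exp_space :: "'a topology \<Rightarrow> 'a set set" where
  "exp_space X = {F. closedin X F \<and> F \<noteq> {}}"

lemma exp_space_subset: "F \<in> exp_space X \<Longrightarrow> F \<subseteq> topspace X"
  by (simp add: exp_space_def closedin_subset)

definition lower_topology :: "'a topology \<Rightarrow> 'a set topology" where
  "lower_topology X =
     topology_generated_by {{F \<in> exp_space X. F \<inter> U \<noteq> {}} | U. openin X U}"

definition vietoris_topology :: "'a topology \<Rightarrow> 'a set topology" where
  "vietoris_topology X =
     topology_generated_by
       ({{F \<in> exp_space X. F \<inter> U \<noteq> {}} | U. openin X U} \<union>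
        {{F \<in> exp_space X. F \<subseteq> U} | U. openin X U})"

lemma topspace_lower_topology: "topspace (lower_topology X) = exp_space X"
proof -
  have "F \<inter> topspace X \<noteq> {}" if "F \<in> exp_space X" for F
    using exp_space_subset[OF that] that by (auto simp: exp_space_def)
  then have "exp_space X \<subseteq> {F \<in> exp_space X. F \<inter> topspace X \<noteq> {}}"
    by blast
  then show ?thesis
    unfolding lower_topology_def topology_generated_by_topspace
    using openin_topspace by blast
qed

lemma topspace_vietoris_topology: "topspace (vietoris_topology X) = exp_space X"
proof -
  have "F \<inter> topspace X \<noteq> {}" if "F \<in> exp_space X" for F
    using exp_space_subset[OF that] that by (auto simp: exp_space_def)
  then have "exp_space X \<subseteq> {F \<in> exp_space X. F \<inter> topspace X \<noteq> {}}"
    by blast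
  then show ?thesis
    unfolding vietoris_topology_def topology_generated_by_topspace
    using openin_topspace by blast
qed


section \<open>Inclusion hyperspaces\<close>

definition compact_inclusion_hyperspaces :: "'a topology \<Rightarrow> 'a set set set" where
  "compact_inclusion_hyperspaces X =
     {\<F>. \<F> \<noteq> {} \<and> \<F> \<subseteq> exp_space X \<and>
          (\<forall>A B. A \<in> \<F> \<and> A \<subseteq> B \<and> closedin X B \<longrightarrow> B \<in> \<F>) \<and>
          compactin (lower_topology X) \<F>}"

definition inclusion_hyperspaces :: "'a topology \<Rightarrow> 'a set set set" where
  "inclusion_hyperspaces K =
     {\<F>. \<F> \<noteq> {} \<and> \<F> \<subseteq> exp_space K \<and> closedin (vietoris_topology K) \<F> \<and>
          (\<forall>A B. A \<in> \<F> \<and> A \<subseteq> B \<and> B \<in> exp_space K \<longrightarrow> B \<in> \<F>)}"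

definition G_space :: "'a topology \<Rightarrow> 'a set set topology" where
  "G_space K =
     topology_generated_by
       ({{\<F> \<in> inclusion_hyperspaces K. \<exists>F\<in>\<F>. F \<subseteq> U} | U. openin K U} \<union>
        {{\<F> \<in> inclusion_hyperspaces K. \<forall>F\<in>\<F>. F \<inter> U \<noteq> {}} | U. openin K U})"

lemma topspace_G_space: "topspace (G_space K) = inclusion_hyperspaces K"
proof -
  have "\<exists>F\<in>\<F>. F \<subseteq> topspace K" if "\<F> \<in> inclusion_hyperspaces K" for \<F>
  proof -
    from that obtain F where "F \<in> \<F>" "F \<in> exp_space K"
      unfolding inclusion_hyperspaces_def by blast
    then show ?thesis using exp_space_subset by blast
  qed
  then have "inclusion_hyperspaces K \<subseteq>
      {\<F> \<in> inclusion_hyperspaces K. \<exists>F\<in>\<F>. F \<subseteq> topspace K}"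
    by blast
  then show ?thesis
    unfolding G_space_def topology_generated_by_topspace
    using openin_topspace by blast
qed


section \<open>The Stone--Cech compactification\<close>

text \<open>
  The Stone--Cech compactification of a Tychonoff space is realised as the closure of the image of
  its canonical embedding into the cube with one unit-interval factor for each continuous map into
  the unit interval. Maps are normalised to be \<^const>\<open>undefined\<close> outside the space, so that
  each of them gives exactly one factor.
\<close>

definition unit_maps :: "'a topology \<Rightarrow> ('a \<Rightarrow> real) set" where
  "unit_maps X = {h \<in> extensional (topspace X). continuous_map X (top_of_set {0..1}) h}"

definition unit_cube :: "'a topology \<Rightarrow> (('a \<Rightarrow> real) \<Rightarrow> real) topology" where
  "unit_cube X = product_topology (\<lambda>h. top_of_set {0..1}) (unit_maps X)"

definition beta_emb :: "'a topology \<Rightarrow> 'a \<Rightarrow> ('a \<Rightarrow> real) \<Rightarrow> real" where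
  "beta_emb X x = (\<lambda>h\<in>unit_maps X. h x)"

definition beta_space :: "'a topology \<Rightarrow> (('a \<Rightarrow> real) \<Rightarrow> real) topology" where
  "beta_space X =
     subtopology (unit_cube X) (unit_cube X closure_of (beta_emb X ` topspace X))"

lemma unit_maps_eq:
  "unit_maps X =
     mspace (submetric (cfunspace X euclidean_metric) {f. f \<in> topspace X \<rightarrow> {0..1::real}})"
proof -
  have "bounded (h ` topspace X)" if "h \<in> topspace X \<rightarrow> {0..1}" for h :: "'a \<Rightarrow> real"
    by (rule bounded_subset[OF bounded_closed_interval]) (use that in blast)
  then show ?thesis
    by (auto simp: unit_maps_def continuous_map_in_subtopology image_subset_iff_funcset)
qed

lemma embedding_map_unit_cube:
  assumes "tychonoff_space X"
  shows "embedding_map X (unit_cube X) (beta_emb X)"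
  using assms unfolding tychonoff_space_def unit_cube_def beta_emb_def unit_maps_eq
  by (elim conjE) (rule completely_regular_space_cube_embedding_explicit)

lemma beta_emb_in_closure:
  "beta_emb X ` topspace X \<subseteq> unit_cube X closure_of (beta_emb X ` topspace X)"
proof (rule closure_of_subset)
  show "beta_emb X ` topspace X \<subseteq> topspace (unit_cube X)"
    unfolding unit_cube_def topspace_product_topology beta_emb_def
    by (intro image_subsetI restrict_PiE_iff[THEN iffD2] ballI)
      (auto simp: unit_maps_def continuous_map_def)
qed

lemma topspace_beta_space:
  "topspace (beta_space X) = unit_cube X closure_of (beta_emb X ` topspace X)"
  unfolding beta_space_def topspace_subtopology
  using closure_of_subset_topspace by (rule Int_absorb1)

lemma embedding_map_beta_emb:
  assumes "tychonoff_space X"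
  shows "embedding_map X (beta_space X) (beta_emb X)"
  using embedding_map_unit_cube[OF assms] beta_emb_in_closure[of X]
  by (simp add: beta_space_def embedding_map_in_subtopology)

lemma compact_space_beta_space: "compact_space (beta_space X)"
proof -
  have "compact_space (unit_cube X)"
    unfolding unit_cube_def
    using compact_space_product_topology compact_space_subtopology compactin_euclidean_iff by blast
  then show ?thesis
    by (simp add: beta_space_def closedin_compact_space compact_space_subtopology)
qed

lemma Hausdorff_space_beta_space: "Hausdorff_space (beta_space X)"
  unfolding beta_space_def unit_cube_def
  by (intro Hausdorff_space_subtopology)
    (simp add: Hausdorff_space_product_topology Hausdorff_space_subtopology)

lemma dense_beta_emb:
  "beta_space X closure_of (beta_emb X ` topspace X) = topspace (beta_space X)"
  unfolding topspace_beta_space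
  unfolding beta_space_def closure_of_subtopology Int_absorb1[OF beta_emb_in_closure]
  by (rule Int_absorb)

lemma beta_space_extension:
  assumes "continuous_map X (top_of_set {0..1::real}) h"
  shows "\<exists>g. continuous_map (beta_space X) (top_of_set {0..1}) g \<and>
             (\<forall>x\<in>topspace X. g (beta_emb X x) = h x)"
proof -
  let ?h = "restrict h (topspace X)"
  have h: "?h \<in> unit_maps X"
    using assms continuous_map_eq[of X _ h ?h] by (auto simp: unit_maps_def)
  have "continuous_map (beta_space X) (top_of_set {0..1}) (\<lambda>p. p ?h)"
    unfolding beta_space_def unit_cube_def
    by (intro continuous_map_from_subtopology continuous_map_product_projection h)
  with h show ?thesis
    by (intro exI[of _ "\<lambda>p. p ?h"]) (simp add: beta_emb_def)
qed


section \<open>The space of compact inclusion hyperspaces\<close>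

text \<open>
  A subset of the compactification meets the space \<open>X\<close> itself in its preimage under the canonical
  embedding.
\<close>

definition e_G :: "'a topology \<Rightarrow> 'a set set \<Rightarrow> (('a \<Rightarrow> real) \<Rightarrow> real) set set" where
  "e_G X \<F> = {A \<in> exp_space (beta_space X). beta_emb X -` A \<inter> topspace X \<in> \<F>}"

definition G_check :: "'a topology \<Rightarrow> 'a set set topology" where
  "G_check X = pullback_topology (compact_inclusion_hyperspaces X) (e_G X) (G_space (beta_space X))"

definition G_check_map :: "'b topology \<Rightarrow> ('a \<Rightarrow> 'b) \<Rightarrow> 'a set set \<Rightarrow> 'b set set" where
  "G_check_map Y f \<F> = {B. closedin Y B \<and> (\<exists>F\<in>\<F>. f ` F \<subseteq> B)}"

definition eta_G :: "'a topology \<Rightarrow> 'a \<Rightarrow> 'a set set" where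
  "eta_G X x = {F \<in> exp_space X. x \<in> F}"

definition mu_G :: "'a topology \<Rightarrow> 'a set set set set \<Rightarrow> 'a set set" where
  "mu_G X \<FF> = {F \<in> exp_space X. \<exists>H\<in>\<FF>. F \<in> \<Inter>H}"

lemma G_check_map_cong:
  assumes "\<F> \<subseteq> exp_space X" "\<And>x. x \<in> topspace X \<Longrightarrow> f x = g x"
  shows "G_check_map Y f \<F> = G_check_map Y g \<F>"
proof -
  have "f ` F = g ` F" if "F \<in> \<F>" for F
    using that assms exp_space_subset by (intro image_cong) blast+
  then show ?thesis
    by (simp add: G_check_map_def)
qed

lemma e_G_in_inclusion_hyperspaces:
  assumes X: "tychonoff_space X" and \<F>: "\<F> \<in> compact_inclusion_hyperspaces X"
  shows "e_G X \<F> \<in> inclusion_hyperspaces (beta_space X)"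
proof -
  let ?b = "beta_space X" and ?i = "beta_emb X"
  let ?pre = "\<lambda>A. ?i -` A \<inter> topspace X"
  have cont: "continuous_map X ?b ?i"
    using homeomorphic_imp_continuous_map[OF embedding_map_beta_emb[OF X, unfolded embedding_map_def]]
    by (simp add: continuous_map_in_subtopology)
  have pre_eq: "?pre A = {x \<in> topspace X. ?i x \<in> A}" for A
    by auto
  have pre_closed: "closedin X (?pre A)" if "closedin ?b A" for A
    unfolding pre_eq using closedin_continuous_map_preimage[OF cont that] .
  have pre_open: "openin X (?pre A)" if "openin ?b A" for A
    unfolding pre_eq using openin_continuous_map_preimage[OF cont that] .
  have i_in: "?i x \<in> topspace ?b" if "x \<in> topspace X" for x
    using cont that by (auto simp: continuous_map_def)
  have sub: "\<F> \<subseteq> exp_space X" and "\<F> \<noteq> {}"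
    and up: "\<And>A B. \<lbrakk>A \<in> \<F>; A \<subseteq> B; closedin X B\<rbrakk> \<Longrightarrow> B \<in> \<F>"
    and comp: "compactin (lower_topology X) \<F>"
    using \<F> by (auto simp: compact_inclusion_hyperspaces_def)
  have sub_top: "F \<subseteq> topspace X" "F \<noteq> {}" if "F \<in> \<F>" for F
    using that sub closedin_subset by (auto simp: exp_space_def)
  have in_exp: "A \<in> exp_space ?b" if "closedin ?b A" "?pre A \<in> \<F>" for A
    using that sub_top by (fastforce simp: exp_space_def)
  obtain F0 where F0: "F0 \<in> \<F>"
    using \<open>\<F> \<noteq> {}\<close> by blast
  have "F0 \<subseteq> ?pre (topspace ?b)"
    using sub_top(1)[OF F0] i_in by blast
  then have "?pre (topspace ?b) \<in> \<F>"
    by (rule up[OF F0 _ pre_closed[OF closedin_topspace]])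
  then have ne: "e_G X \<F> \<noteq> {}"
    using in_exp[of "topspace ?b"] by (auto simp: e_G_def)
  have upw: "B \<in> e_G X \<F>" if "A \<in> e_G X \<F>" "A \<subseteq> B" "B \<in> exp_space ?b" for A B
  proof -
    have "?pre A \<in> \<F>" "closedin ?b B"
      using that by (auto simp: e_G_def exp_space_def)
    moreover have "?pre A \<subseteq> ?pre B"
      using \<open>A \<subseteq> B\<close> by blast
    ultimately have "?pre B \<in> \<F>"
      using up pre_closed by metis
    with that show ?thesis by (simp add: e_G_def)
  qed
  have reg: "regular_space ?b"
    by (simp add: compact_Hausdorff_imp_regular_space compact_space_beta_space
        Hausdorff_space_beta_space)
  have "openin (vietoris_topology ?b) (exp_space ?b - e_G X \<F>)"
  proof (subst openin_subopen, intro ballI)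
    fix A assume A: "A \<in> exp_space ?b - e_G X \<F>"
    then have clA: "closedin ?b A" and nA: "?pre A \<notin> \<F>"
      by (auto simp: e_G_def exp_space_def)
    define W where "W = {U. openin ?b U \<and> A \<inter> ?b closure_of U = {}}"
    have cover: "\<exists>U\<in>W. F \<inter> ?pre U \<noteq> {}" if F: "F \<in> \<F>" for F
    proof -
      have "\<not> F \<subseteq> ?pre A"
        using up[OF F _ pre_closed[OF clA]] nA by blast
      then obtain x where x: "x \<in> F" "?i x \<notin> A"
        using sub_top[OF F] by blast
      with sub_top[OF F] have xt: "x \<in> topspace X" "?i x \<in> topspace ?b - A"
        using i_in by auto
      then obtain U V where "openin ?b U" "openin ?b V" "?i x \<in> U" "A \<subseteq> V" "disjnt U V"
        using reg[unfolded regular_space_def, rule_format, OF conjI[OF clA xt(2)]] by metis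
      then have "U \<in> W"
        unfolding W_def using openin_Int_closure_of_eq_empty[of ?b V U]
        by (auto simp: disjnt_def Int_commute)
      moreover have "x \<in> F \<inter> ?pre U"
        using \<open>?i x \<in> U\<close> x xt by simp
      ultimately show ?thesis by blast
    qed
    let ?N = "\<lambda>U. {F \<in> exp_space X. F \<inter> ?pre U \<noteq> {}}"
    have opN: "\<And>N. N \<in> ?N ` W \<Longrightarrow> openin (lower_topology X) N"
      unfolding lower_topology_def
      by (rule topology_generated_by_Basis) (use pre_open W_def in blast)
    have "\<F> \<subseteq> \<Union> (?N ` W)"
      using cover sub by auto
    then obtain N' where N': "finite N'" "N' \<subseteq> ?N ` W" "\<F> \<subseteq> \<Union> N'"
      using comp opN unfolding compactin_def by meson
    obtain W' where W': "W' \<subseteq> W" "finite W'" "N' = ?N ` W'"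
      using finite_subset_image[OF N'(1,2)] by blast
    define V where "V = topspace ?b - (\<Union>U\<in>W'. ?b closure_of U)"
    have opV: "openin ?b V"
      unfolding V_def using W' by (intro openin_diff closedin_Union) auto
    have "A \<subseteq> V"
      using W'(1) closedin_subset[OF clA] unfolding V_def W_def by blast
    let ?T = "{B \<in> exp_space ?b. B \<subseteq> V}"
    have "B \<notin> e_G X \<F>" if "B \<subseteq> V" for B
    proof
      assume "B \<in> e_G X \<F>"
      then have "?pre B \<in> \<F>" by (simp add: e_G_def)
      then obtain U where U: "U \<in> W'" "?pre B \<inter> ?pre U \<noteq> {}"
        using N'(3) unfolding W'(3) by blast
      have "openin ?b U"
        using U(1) W'(1) W_def by blast
      then have "U \<subseteq> ?b closure_of U"
        by (intro closure_of_subset openin_subset)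
      with U that show False
        unfolding V_def by blast
    qed
    moreover have "openin (vietoris_topology ?b) ?T"
      unfolding vietoris_topology_def
      by (rule topology_generated_by_Basis) (use opV in blast)
    ultimately show "\<exists>T. openin (vietoris_topology ?b) T \<and> A \<in> T \<and> T \<subseteq> exp_space ?b - e_G X \<F>"
      using A \<open>A \<subseteq> V\<close> by (intro exI[of _ ?T]) auto
  qed
  then have "closedin (vietoris_topology ?b) (e_G X \<F>)"
    by (auto simp: closedin_def topspace_vietoris_topology e_G_def)
  with ne upw show ?thesis
    unfolding inclusion_hyperspaces_def by (auto simp: e_G_def)
qed

lemma topspace_G_check:
  assumes "tychonoff_space X"
  shows "topspace (G_check X) = compact_inclusion_hyperspaces X"
  using e_G_in_inclusion_hyperspaces[OF assms]
  by (auto simp: G_check_def topspace_pullback_topology topspace_G_space)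

lemma inj_on_e_G:
  assumes X: "tychonoff_space X"
  shows "inj_on (e_G X) (compact_inclusion_hyperspaces X)"
proof -
  let ?b = "beta_space X" and ?i = "beta_emb X"
  have emb: "embedding_map X ?b ?i"
    using embedding_map_beta_emb[OF X] .
  have "\<exists>A\<in>exp_space ?b. ?i -` A \<inter> topspace X = F" if F: "F \<in> exp_space X" for F
  proof -
    have "closedin (subtopology ?b (?i ` topspace X)) (?i ` F)"
      using emb F homeomorphic_map_closedness_eq by (fastforce simp: embedding_map_def exp_space_def)
    then obtain A where A: "closedin ?b A" "?i ` F = A \<inter> ?i ` topspace X"
      by (auto simp: closedin_subtopology)
    have inj: "inj_on ?i (topspace X)"
      using emb homeomorphic_imp_injective_map by (auto simp: embedding_map_def)
    have F': "F \<subseteq> topspace X" "F \<noteq> {}"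
      using F exp_space_subset by (auto simp: exp_space_def)
    have "x \<in> F \<longleftrightarrow> ?i x \<in> A" if "x \<in> topspace X" for x
      using inj_on_image_mem_iff[OF inj that F'(1)] that unfolding A(2) by simp
    with F' have "?i -` A \<inter> topspace X = F"
      by auto
    with A F' show ?thesis
      by (intro bexI[of _ A]) (auto simp: exp_space_def)
  qed
  then have mem: "\<F> \<subseteq> \<G>"
    if "\<F> \<in> compact_inclusion_hyperspaces X" "e_G X \<F> = e_G X \<G>" for \<F> \<G>
    using that unfolding compact_inclusion_hyperspaces_def e_G_def by blast
  show ?thesis
    by (rule inj_onI) (metis mem subset_antisym)
qed

end

theory Submission
  imports Defs
begin

text \<open>
  An up-closed collection \<open>\<F>\<close> is compact in the lower topology iff it is stable under intersections
  of down-directed families. Hence for \<open>h : X \<rightarrow> [0,1]\<close> the infimum over \<open>F \<in> \<F>\<close> of the suprema of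
  \<open>h\<close> on \<open>F\<close>, the level of \<open>\<F>\<close> at \<open>h\<close>, satisfies: the level is at most \<open>a\<close> iff \<open>{h \<le> a} \<in> \<F>\<close>.
  The topology of the space of compact inclusion hyperspaces is the initial one for all level
  functions; this gives the Tychonoff property, and it reduces continuity of the structure maps to
  \<open>level h (Gf \<F>) = level (h \<circ> f) \<F>\<close>, \<open>level h (\<eta> x) = h x\<close> and
  \<open>level h (\<mu> \<FF>) = level (level h) \<FF>\<close>. The equations are then Boolean: a closed \<open>B\<close> belongs to \<open>Gf \<F>\<close>
  iff \<open>f\<inverse>(B) \<in> \<F>\<close>, and a closed \<open>F\<close> belongs to \<open>\<mu> \<FF>\<close> iff \<open>{\<F>. F \<in> \<F>} \<in> \<FF>\<close>.
\<close>

section \<open>Compactness and directed intersections\<close>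

text \<open>Nonemptiness is part of the notion because \<open>\<Inter>{}\<close> is
  \<open>UNIV\<close>, which need not be a closed subset of the space.\<close>

definition down_directed :: "'a set set \<Rightarrow> bool" where
  "down_directed \<C> \<longleftrightarrow> \<C> \<noteq> {} \<and> (\<forall>A\<in>\<C>. \<forall>B\<in>\<C>. \<exists>C\<in>\<C>. C \<subseteq> A \<inter> B)"

lemma down_directed_finite_lower_bound:
  assumes "down_directed \<C>" "finite \<A>" "\<A> \<subseteq> \<C>"
  shows "\<exists>C\<in>\<C>. \<forall>A\<in>\<A>. C \<subseteq> A"
  using assms(2,3)
proof (induction \<A>)
  case empty
  then show ?case using assms(1) by (auto simp: down_directed_def)
next
  case (insert A \<A>)
  then obtain C where "C \<in> \<C>" "\<forall>A\<in>\<A>. C \<subseteq> A" by auto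
  moreover obtain D where "D \<in> \<C>" "D \<subseteq> A \<inter> C"
    using assms(1) insert.prems \<open>C \<in> \<C>\<close> unfolding down_directed_def by blast
  ultimately show ?case by (intro bexI[of _ D]) auto
qed

definition up_closed_in :: "'a topology \<Rightarrow> 'a set set \<Rightarrow> bool" where
  "up_closed_in X \<F> \<longleftrightarrow> (\<forall>A B. A \<in> \<F> \<and> A \<subseteq> B \<and> closedin X B \<longrightarrow> B \<in> \<F>)"

text \<open>If no member of \<F> fits inside the intersection, every member meets the complement of
  some C in \<C>, and these conditions form an open cover. A lower bound in \<C> for the finitely
  many C of a subcover is itself a member of \<F>, yet it meets none of their complements.\<close>

lemma Inter_down_directed_in_compact:
  assumes sub: "\<F> \<subseteq> exp_space X" and up: "up_closed_in X \<F>"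
    and comp: "compactin (lower_topology X) \<F>"
    and dir: "down_directed \<C>" and \<C>: "\<C> \<subseteq> \<F>"
  shows "\<Inter>\<C> \<in> \<F>"
proof (rule ccontr)
  assume not: "\<Inter>\<C> \<notin> \<F>"
  have cl: "closedin X C" if "C \<in> \<C>" for C
    using that \<C> sub by (auto simp: exp_space_def)
  have "closedin X (\<Inter>\<C>)"
    using dir cl by (intro closedin_Inter) (auto simp: down_directed_def)
  then have ns: "\<not> F \<subseteq> \<Inter>\<C>" if "F \<in> \<F>" for F
    using that up not by (auto simp: up_closed_in_def)
  let ?N = "\<lambda>C. {F \<in> exp_space X. F \<inter> (topspace X - C) \<noteq> {}}"
  have "openin (lower_topology X) N" if "N \<in> ?N ` \<C>" for N
    unfolding lower_topology_def using that cl
    by (intro topology_generated_by_Basis) blast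
  moreover have "\<F> \<subseteq> \<Union> (?N ` \<C>)"
  proof
    fix F assume F: "F \<in> \<F>"
    then obtain x C where "x \<in> F" "C \<in> \<C>" "x \<notin> C" using ns by blast
    with F sub exp_space_subset[of F X] show "F \<in> \<Union> (?N ` \<C>)" by blast
  qed
  ultimately obtain N' where N': "finite N'" "N' \<subseteq> ?N ` \<C>" "\<F> \<subseteq> \<Union> N'"
    using comp unfolding compactin_def by meson
  obtain \<A> where \<A>: "\<A> \<subseteq> \<C>" "finite \<A>" "N' = ?N ` \<A>"
    using finite_subset_image[OF N'(1,2)] by blast
  obtain C where C: "C \<in> \<C>" "\<forall>A\<in>\<A>. C \<subseteq> A"
    using down_directed_finite_lower_bound[OF dir \<A>(2,1)] by blast
  then have "C \<in> \<Union> (?N ` \<A>)" using N'(3) \<A>(3) \<C> by blast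
  with C show False by blast
qed

text \<open>By the Alexander subbase theorem only covers by subbasic sets need a finite subcover.
  The complements of finite unions of the open sets U involved form a directed family whose
  intersection misses every U. If all of them belonged to \<F>, so would the intersection,
  contradicting the cover. A finite union whose complement is not in \<F> yields the
  subcover.\<close>

lemma compactin_lower_topology:
  assumes sub: "\<F> \<subseteq> exp_space X" and up: "up_closed_in X \<F>"
    and dir: "\<And>\<C>. \<lbrakk>down_directed \<C>; \<C> \<subseteq> \<F>\<rbrakk> \<Longrightarrow> \<Inter>\<C> \<in> \<F>"
  shows "compactin (lower_topology X) \<F>"
proof -
  let ?N = "\<lambda>U. {F \<in> exp_space X. F \<inter> U \<noteq> {}}"
  define \<B> where "\<B> = {?N U | U. openin X U}"
  have lower: "lower_topology X = topology_generated_by \<B>"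
    by (simp add: lower_topology_def \<B>_def)
  have open_lower: "openin (lower_topology X) = arbitrary union_of finite' intersection_of (\<lambda>x. x \<in> \<B>)"
    unfolding lower generate_topology_on_eq[symmetric]
    by (rule ext) (rule openin_topology_generated_by_iff)
  have top: "\<F> \<subseteq> \<Union> \<B>"
    using sub topspace_lower_topology[of X]
    unfolding lower topology_generated_by_topspace by simp
  have fin: "\<exists>C'. finite C' \<and> C' \<subseteq> C \<and> \<F> \<subseteq> \<Union>C'" if C: "C \<subseteq> \<B>" "\<F> \<subseteq> \<Union>C" for C
  proof -
    define W where "W = {U. openin X U \<and> ?N U \<in> C}"
    have CW: "C = ?N ` W" using C(1) by (auto simp: W_def \<B>_def)
    \<comment> \<open>The choice \<open>V = {}\<close> is allowed: it puts \<open>topspace X\<close>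
      into \<C>, which keeps \<C> nonempty and its intersection inside the space.\<close>
    define \<C> where "\<C> = (\<lambda>V. topspace X - \<Union>V) ` {V. finite V \<and> V \<subseteq> W}"
    have "\<exists>C\<in>\<C>. C \<subseteq> A \<inter> B" if AB: "A \<in> \<C>" "B \<in> \<C>" for A B
    proof -
      obtain V V' where "finite V" "V \<subseteq> W" "A = topspace X - \<Union>V"
        "finite V'" "V' \<subseteq> W" "B = topspace X - \<Union>V'"
        using AB by (auto simp: \<C>_def)
      then show ?thesis
        unfolding \<C>_def by (intro bexI[of _ "topspace X - \<Union>(V \<union> V')"] imageI) auto
    qed
    moreover have "\<C> \<noteq> {}" by (auto simp: \<C>_def)
    ultimately have "down_directed \<C>" by (simp add: down_directed_def)
    have I: "\<Inter>\<C> \<subseteq> topspace X - \<Union>W"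
    proof
      fix x assume x: "x \<in> \<Inter>\<C>"
      have "topspace X - \<Union>V \<in> \<C>" if "finite V" "V \<subseteq> W" for V
        using that by (auto simp: \<C>_def)
      from this[of "{}"] this[of "{U}" for U] x show "x \<in> topspace X - \<Union>W"
        by fastforce
    qed
    have "\<Inter>\<C> \<notin> \<F>"
    proof
      assume "\<Inter>\<C> \<in> \<F>"
      then obtain U where "U \<in> W" "\<Inter>\<C> \<inter> U \<noteq> {}" using C(2) unfolding CW by blast
      with I show False by blast
    qed
    then obtain V where V: "finite V" "V \<subseteq> W" "topspace X - \<Union>V \<notin> \<F>"
      using dir[OF \<open>down_directed \<C>\<close>] by (auto simp: \<C>_def)
    have "closedin X (topspace X - \<Union>V)"
      using V(2) by (intro closedin_diff openin_Union) (auto simp: W_def)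
    then have ns: "\<not> F \<subseteq> topspace X - \<Union>V" if "F \<in> \<F>" for F
      using that up V(3) by (auto simp: up_closed_in_def)
    have "\<F> \<subseteq> \<Union> (?N ` V)"
    proof
      fix F assume F: "F \<in> \<F>"
      with sub have "F \<in> exp_space X" by blast
      with ns[OF F] exp_space_subset[OF this] obtain U where "U \<in> V" "F \<inter> U \<noteq> {}" by blast
      with \<open>F \<in> exp_space X\<close> show "F \<in> \<Union> (?N ` V)" by blast
    qed
    then show ?thesis
      using V(1,2) unfolding CW by (intro exI[of _ "?N ` V"]) auto
  qed
  have "compact_space (subtopology (lower_topology X) \<F>)"
  proof (rule Alexander_subbase_alt[OF top fin])
    let ?S = "subtopology (lower_topology X) \<F>"
    let ?fin = "finite intersection_of (\<lambda>x. x \<in> \<B>) relative_to \<F>"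
    have top_S: "topspace ?S = \<F>"
      using sub by (simp add: topspace_lower_topology Int_absorb1)
    \<comment> \<open>The generated topology is built from nonempty finite intersections
      (\<open>finite'\<close>), the Alexander theorem from all finite ones relative to \<F>. The
      empty intersection contributes only \<F> itself, which is the whole subspace, so the
      topologies agree.\<close>
    have "(arbitrary union_of ?fin) T = openin ?S T" for T
    proof
      have "openin ?S A" if "?fin A" for A
      proof -
        obtain V where "(finite intersection_of (\<lambda>x. x \<in> \<B>)) V" "\<F> \<inter> V = A"
          using \<open>?fin A\<close> unfolding relative_to_def by (elim exE conjE)
        then obtain \<A> where "finite \<A>" "\<A> \<subseteq> \<B>" "A = \<F> \<inter> \<Inter>\<A>"
          unfolding intersection_of_def by auto
        moreover have "openin (lower_topology X) B" if "B \<in> \<B>" for B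
          unfolding lower by (rule topology_generated_by_Basis[OF that])
        ultimately have "A = \<F> \<inter> \<Inter>\<A>" "\<forall>B\<in>\<A>. openin (lower_topology X) B" "finite \<A>"
          by blast+
        then show ?thesis
        proof (cases "\<A> = {}")
          case True
          then show ?thesis
            using \<open>A = \<F> \<inter> \<Inter>\<A>\<close> openin_topspace[of ?S] top_S by simp
        next
          case False
          with \<open>finite \<A>\<close> \<open>\<forall>B\<in>\<A>. openin (lower_topology X) B\<close> show ?thesis
            unfolding \<open>A = \<F> \<inter> \<Inter>\<A>\<close> by (intro openin_subtopology_Int2 openin_Inter) auto
        qed
      qed
      then show "openin ?S T" if "(arbitrary union_of ?fin) T"
        using that by (auto simp: union_of_def)
    next
      assume "openin ?S T"
      then have "((arbitrary union_of (finite' intersection_of (\<lambda>x. x \<in> \<B>))) relative_to \<F>) T"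
        unfolding openin_relative_to[symmetric] open_lower .
      then have "(arbitrary union_of ((finite' intersection_of (\<lambda>x. x \<in> \<B>)) relative_to \<F>)) T"
        by (simp add: arbitrary_union_of_relative_to)
      then show "(arbitrary union_of ?fin) T"
        by (rule union_of_mono) (auto simp: relative_to_def intersection_of_def)
    qed
    then have "arbitrary union_of ?fin = openin ?S" by (rule ext)
    then show "topology (arbitrary union_of ?fin) = ?S" by (simp only: openin_inverse)
  qed
  then show ?thesis
    using sub by (simp add: compactin_subspace topspace_lower_topology)
qed


text \<open>Replaces compactness by an order-theoretic closure condition, so that later
  constructions never have to handle covers in the lower topology.\<close>

lemma compact_inclusion_hyperspaces_iff:
  "\<F> \<in> compact_inclusion_hyperspaces X \<longleftrightarrow>
    \<F> \<noteq> {} \<and> \<F> \<subseteq> exp_space X \<and> up_closed_in X \<F> \<and>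
    (\<forall>\<C>. down_directed \<C> \<and> \<C> \<subseteq> \<F> \<longrightarrow> \<Inter>\<C> \<in> \<F>)"
proof -
  have "compactin (lower_topology X) \<F> \<longleftrightarrow> (\<forall>\<C>. down_directed \<C> \<and> \<C> \<subseteq> \<F> \<longrightarrow> \<Inter>\<C> \<in> \<F>)"
    if "\<F> \<subseteq> exp_space X" "up_closed_in X \<F>"
    using that Inter_down_directed_in_compact[of \<F> X] compactin_lower_topology[of \<F> X] by blast
  then show ?thesis
    by (auto simp: compact_inclusion_hyperspaces_def up_closed_in_def)
qed

section \<open>Closure properties of a compact inclusion hyperspace\<close>

context
  fixes X :: "'a topology" and \<F> :: "'a set set"
  assumes \<F>: "\<F> \<in> compact_inclusion_hyperspaces X"
begin

lemma cih_closedin: "F \<in> \<F> \<Longrightarrow> closedin X F"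
  and cih_nonempty: "{} \<notin> \<F>"
  and cih_up: "\<lbrakk>A \<in> \<F>; A \<subseteq> B; closedin X B\<rbrakk> \<Longrightarrow> B \<in> \<F>"
  and cih_Inter: "\<lbrakk>down_directed \<C>; \<C> \<subseteq> \<F>\<rbrakk> \<Longrightarrow> \<Inter>\<C> \<in> \<F>"
  using \<F> by (auto simp: compact_inclusion_hyperspaces_iff exp_space_def up_closed_in_def)

lemma cih_subset: "F \<in> \<F> \<Longrightarrow> F \<subseteq> topspace X"
  by (rule closedin_subset[OF cih_closedin])

lemma cih_topspace: "topspace X \<in> \<F>"
proof -
  obtain F where "F \<in> \<F>" using \<F> by (auto simp: compact_inclusion_hyperspaces_iff)
  then show ?thesis using cih_up cih_subset by blast
qed

end

section \<open>Level functions\<close>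

abbreviation unit_valued :: "'a topology \<Rightarrow> ('a \<Rightarrow> real) \<Rightarrow> bool" where
  "unit_valued X h \<equiv> continuous_map X (top_of_set {0..1}) h"

definition sublevel :: "'a topology \<Rightarrow> ('a \<Rightarrow> real) \<Rightarrow> real \<Rightarrow> 'a set" where
  "sublevel X h a = {x \<in> topspace X. h x \<le> a}"

definition level :: "'a topology \<Rightarrow> ('a \<Rightarrow> real) \<Rightarrow> 'a set set \<Rightarrow> real" where
  "level X h \<F> = Inf {a. sublevel X h a \<in> \<F>}"

lemma unit_valued_real: "unit_valued X h \<Longrightarrow> continuous_map X euclideanreal h"
  and unit_valued_bounds: "unit_valued X h \<Longrightarrow> x \<in> topspace X \<Longrightarrow> 0 \<le> h x \<and> h x \<le> 1"
  by (auto simp: continuous_map_in_subtopology)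

lemma closedin_sublevel: "continuous_map X euclideanreal h \<Longrightarrow> closedin X (sublevel X h a)"
  unfolding sublevel_def using closedin_continuous_map_preimage[of X euclideanreal h "{..a}"] by simp

text \<open>The point is that the infimum is attained. The sublevel sets belonging to \<F> form a
  chain, so their intersection, which lies in the sublevel set at the infimum, belongs to \<F>. The
  infimum is over a nonempty set bounded below: 1 is admissible since h is at most 1, and negative
  numbers are not since \<F> omits the empty set.\<close>

lemma level_le_iff:
  assumes \<F>: "\<F> \<in> compact_inclusion_hyperspaces X" and h: "unit_valued X h"
  shows "level X h \<F> \<le> a \<longleftrightarrow> sublevel X h a \<in> \<F>"
proof -
  define S where "S = {a. sublevel X h a \<in> \<F>}"
  have cl: "closedin X (sublevel X h a)" for a
    using h by (intro closedin_sublevel unit_valued_real)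
  have mono: "sublevel X h a \<subseteq> sublevel X h b" if "a \<le> b" for a b
    using that by (auto simp: sublevel_def)
  have "sublevel X h 1 = topspace X"
    using unit_valued_bounds[OF h] by (auto simp: sublevel_def)
  then have "1 \<in> S" using cih_topspace[OF \<F>] by (simp add: S_def)
  have lb: "0 \<le> a" if "a \<in> S" for a
  proof -
    have "sublevel X h a \<noteq> {}" using that cih_nonempty[OF \<F>] by (auto simp: S_def)
    then show ?thesis using unit_valued_bounds[OF h] by (force simp: sublevel_def)
  qed
  then have bdd: "bdd_below S" by (rule bdd_belowI)
  have "down_directed (sublevel X h ` S)"
    unfolding down_directed_def
  proof (intro conjI ballI)
    fix A B assume "A \<in> sublevel X h ` S" "B \<in> sublevel X h ` S"
    then obtain a b where ab: "a \<in> S" "b \<in> S" "A = sublevel X h a" "B = sublevel X h b" by blast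
    then have "min a b \<in> S" by (simp add: min_def)
    moreover have "sublevel X h (min a b) \<subseteq> A \<inter> B"
      unfolding ab using mono by simp
    ultimately show "\<exists>C\<in>sublevel X h ` S. C \<subseteq> A \<inter> B" by blast
  qed (use \<open>1 \<in> S\<close> in blast)
  then have "\<Inter>(sublevel X h ` S) \<in> \<F>"
    using cih_Inter[OF \<F>] by (auto simp: S_def)
  moreover have "\<Inter>(sublevel X h ` S) \<subseteq> sublevel X h (Inf S)"
    using \<open>1 \<in> S\<close> cInf_greatest[of S] by (fastforce simp: sublevel_def)
  ultimately have Inf: "sublevel X h (Inf S) \<in> \<F>"
    using cih_up[OF \<F>] cl by blast
  show ?thesis
  proof
    assume "level X h \<F> \<le> a"
    then have "sublevel X h (Inf S) \<subseteq> sublevel X h a" by (intro mono) (simp add: level_def S_def)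
    with Inf show "sublevel X h a \<in> \<F>" using cih_up[OF \<F>] cl by blast
  next
    assume "sublevel X h a \<in> \<F>"
    then show "level X h \<F> \<le> a"
      using cInf_lower[OF _ bdd] by (simp add: level_def S_def)
  qed
qed

lemma level_bounds:
  assumes \<F>: "\<F> \<in> compact_inclusion_hyperspaces X" and h: "unit_valued X h"
  shows "0 \<le> level X h \<F>" "level X h \<F> \<le> 1"
proof -
  have "sublevel X h 1 = topspace X"
    using unit_valued_bounds[OF h] by (auto simp: sublevel_def)
  then show "level X h \<F> \<le> 1" using cih_topspace[OF \<F>] by (simp add: level_le_iff[OF \<F> h])
  have "sublevel X h (level X h \<F>) \<noteq> {}"
    using level_le_iff[OF \<F> h, of "level X h \<F>"] cih_nonempty[OF \<F>] by auto
  then show "0 \<le> level X h \<F>" using unit_valued_bounds[OF h] by (force simp: sublevel_def)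
qed

text \<open>Complete regularity makes F the intersection of the zero sublevel sets of all h
  vanishing on F. This family is directed, so if each of these sets belonged to \<F>, F would as
  well.\<close>

lemma separating_unit_valued:
  assumes X: "tychonoff_space X" and \<F>: "\<F> \<in> compact_inclusion_hyperspaces X"
    and F: "closedin X F" "F \<notin> \<F>"
  obtains h where "unit_valued X h" "h ` F \<subseteq> {0}" "0 < level X h \<F>"
proof -
  define H where "H = {h. unit_valued X h \<and> h ` F \<subseteq> {0}}"
  have "down_directed ((\<lambda>h. sublevel X h 0) ` H)"
    unfolding down_directed_def
  proof (intro conjI ballI)
    have "(\<lambda>_. 0) \<in> H" by (auto simp: H_def)
    then show "(\<lambda>h. sublevel X h 0) ` H \<noteq> {}" by blast
    fix A B assume "A \<in> (\<lambda>h. sublevel X h 0) ` H" "B \<in> (\<lambda>h. sublevel X h 0) ` H"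
    then obtain f g where fg: "f \<in> H" "g \<in> H" "A = sublevel X f 0" "B = sublevel X g 0" by blast
    \<comment> \<open>Directedness: the maximum is at most 0 exactly where both functions
      are.\<close>
    then have "(\<lambda>x. max (f x) (g x)) \<in> H"
      using continuous_map_real_max[of X f g]
      by (auto simp: H_def continuous_map_in_subtopology Pi_iff image_subset_iff le_max_iff_disj)
    moreover have "sublevel X (\<lambda>x. max (f x) (g x)) 0 \<subseteq> A \<inter> B"
      unfolding fg by (auto simp: sublevel_def)
    ultimately show "\<exists>C\<in>(\<lambda>h. sublevel X h 0) ` H. C \<subseteq> A \<inter> B" by blast
  qed
  moreover have "\<Inter>((\<lambda>h. sublevel X h 0) ` H) \<subseteq> F"
  proof
    fix x assume x: "x \<in> \<Inter>((\<lambda>h. sublevel X h 0) ` H)"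
    have "(\<lambda>_. 0) \<in> H" by (auto simp: H_def)
    with x have xt: "x \<in> topspace X" by (auto simp: sublevel_def)
    show "x \<in> F"
    proof (rule ccontr)
      assume "x \<notin> F"
      then obtain f where f: "unit_valued X f" "f x = 0" "f ` F \<subseteq> {1}"
        using X F(1) xt unfolding tychonoff_space_def completely_regular_space_def by blast
      \<comment> \<open>Complete regularity gives the value 0 at x and 1 on F; after reflection the
        function vanishes on F and is 1 at x, so x falls outside its zero sublevel set.\<close>
      then have "(\<lambda>x. 1 - f x) \<in> H"
        by (auto simp: H_def continuous_map_in_subtopology intro!: continuous_intros)
      with x f(2) show False by (fastforce simp: sublevel_def)
    qed
  qed
  ultimately have "\<not> (\<lambda>h. sublevel X h 0) ` H \<subseteq> \<F>"
    using cih_Inter[OF \<F>] cih_up[OF \<F>] F by blast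
  then obtain h where "h \<in> H" "sublevel X h 0 \<notin> \<F>" by blast
  then show thesis
    using that[of h] level_le_iff[OF \<F>, of h 0] by (auto simp: H_def)
qed

text \<open>Complements \<open>separating_unit_valued\<close>: in a Tychonoff space, a closed F is
  in \<F> iff every h vanishing on F has level 0 at \<F>.\<close>

lemma level_nonpos:
  assumes \<F>: "\<F> \<in> compact_inclusion_hyperspaces X" and h: "unit_valued X h"
    and F: "F \<in> \<F>" "h ` F \<subseteq> {0}"
  shows "level X h \<F> \<le> 0"
proof -
  have "F \<subseteq> sublevel X h 0"
    using F cih_subset[OF \<F> F(1)] by (auto simp: sublevel_def)
  then show ?thesis
    using cih_up[OF \<F> F(1)] closedin_sublevel[OF unit_valued_real[OF h]]
    by (simp add: level_le_iff[OF \<F> h])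
qed

section \<open>The topology generated by the level functions\<close>

lemma continuous_map_beta_emb:
  assumes "tychonoff_space X"
  shows "continuous_map X (beta_space X) (beta_emb X)"
  using homeomorphic_imp_continuous_map[OF embedding_map_beta_emb[OF assms, unfolded embedding_map_def]]
  by (simp add: continuous_map_in_subtopology)

lemma mem_e_G_iff:
  assumes \<F>: "\<F> \<in> compact_inclusion_hyperspaces X"
  shows "A \<in> e_G X \<F> \<longleftrightarrow> closedin (beta_space X) A \<and> {x \<in> topspace X. beta_emb X x \<in> A} \<in> \<F>"
proof -
  have "beta_emb X -` A \<inter> topspace X = {x \<in> topspace X. beta_emb X x \<in> A}" by auto
  moreover have "A \<noteq> {}" if "{x \<in> topspace X. beta_emb X x \<in> A} \<in> \<F>"
    using that cih_nonempty[OF \<F>] by auto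
  ultimately show ?thesis by (auto simp: e_G_def exp_space_def)
qed

lemma openin_G_checkI:
  assumes "openin (G_space (beta_space X)) U"
  shows "openin (G_check X) {\<F> \<in> compact_inclusion_hyperspaces X. e_G X \<F> \<in> U}"
  unfolding G_check_def openin_pullback_topology using assms by blast

lemma openin_G_space_subset:
  assumes "openin K U"
  shows "openin (G_space K) {\<F> \<in> inclusion_hyperspaces K. \<exists>F\<in>\<F>. F \<subseteq> U}"
  unfolding G_space_def by (rule topology_generated_by_Basis) (use assms in blast)

lemma openin_G_space_meets:
  assumes "openin K U"
  shows "openin (G_space K) {\<F> \<in> inclusion_hyperspaces K. \<forall>F\<in>\<F>. F \<inter> U \<noteq> {}}"
  unfolding G_space_def by (rule topology_generated_by_Basis) (use assms in blast)

text \<open>Let g extend h over the Stone-Cech compactification. A level below a means that some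
  member of \<open>e_G X \<F>\<close> lies in \<open>{g < a}\<close>, a level above a that every
  member meets \<open>{g > a}\<close>. Both are subbasic conditions in
  \<open>G_space (beta_space X)\<close>, so the level is semicontinuous from both sides.\<close>

lemma unit_valued_level:
  assumes X: "tychonoff_space X" and h: "unit_valued X h"
  shows "unit_valued (G_check X) (level X h)"
proof -
  let ?b = "beta_space X" and ?cih = "compact_inclusion_hyperspaces X"
  obtain g where g: "unit_valued ?b g" and gh: "\<And>x. x \<in> topspace X \<Longrightarrow> g (beta_emb X x) = h x"
    using beta_space_extension[OF h] by blast
  have gc: "continuous_map ?b euclideanreal g" by (rule unit_valued_real[OF g])
  have emb: "beta_emb X x \<in> topspace ?b" if "x \<in> topspace X" for x
    using continuous_map_beta_emb[OF X] that by (auto simp: continuous_map_def)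
  have sub: "{x \<in> topspace X. beta_emb X x \<in> sublevel ?b g a} = sublevel X h a" for a
    using emb gh by (auto simp: sublevel_def)
  have cl: "closedin ?b (sublevel ?b g a)" for a
    by (rule closedin_sublevel[OF gc])
  have in_e: "sublevel ?b g a \<in> e_G X \<F> \<longleftrightarrow> level X h \<F> \<le> a" if "\<F> \<in> ?cih" for \<F> a
    by (simp add: mem_e_G_iff[OF that] cl sub level_le_iff[OF that h])
  have less: "level X h \<F> < a \<longleftrightarrow> (\<exists>A\<in>e_G X \<F>. A \<subseteq> {p \<in> topspace ?b. g p < a})"
    if \<F>: "\<F> \<in> ?cih" for \<F> a
  proof
    assume "level X h \<F> < a"
    then have "sublevel ?b g (level X h \<F>) \<subseteq> {p \<in> topspace ?b. g p < a}"
      by (auto simp: sublevel_def)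
    then show "\<exists>A\<in>e_G X \<F>. A \<subseteq> {p \<in> topspace ?b. g p < a}"
      using in_e[OF \<F>, of "level X h \<F>"] by blast
  next
    assume "\<exists>A\<in>e_G X \<F>. A \<subseteq> {p \<in> topspace ?b. g p < a}"
    then obtain A where A: "A \<in> e_G X \<F>" "A \<subseteq> {p \<in> topspace ?b. g p < a}" by blast
    then have Acl: "closedin ?b A" "A \<noteq> {}" by (auto simp: e_G_def exp_space_def)
    then have "compactin ?b A"
      using compact_space_beta_space closedin_compact_space by blast
    then have "compact (g ` A)"
      using image_compactin[OF _ gc] by simp
    \<comment> \<open>The strict inequality needs the maximum of g on the compact set A to be
      attained: a mere supremum could equal a.\<close>
    then obtain p where p: "p \<in> A" "\<And>q. q \<in> A \<Longrightarrow> g q \<le> g p"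
      using compact_attains_sup[of "g ` A"] Acl(2) by auto
    have "A \<subseteq> sublevel ?b g (g p)"
      using p A(2) by (auto simp: sublevel_def)
    then have "{x \<in> topspace X. beta_emb X x \<in> A} \<subseteq> sublevel X h (g p)"
      unfolding sub[symmetric] by blast
    then have "sublevel X h (g p) \<in> \<F>"
      using A(1) cih_up[OF \<F>] closedin_sublevel[OF unit_valued_real[OF h]]
      unfolding mem_e_G_iff[OF \<F>] by blast
    then show "level X h \<F> < a"
      using p(1) A(2) level_le_iff[OF \<F> h, of "g p"] by auto
  qed
  have greater: "a < level X h \<F> \<longleftrightarrow> (\<forall>A\<in>e_G X \<F>. A \<inter> {p \<in> topspace ?b. a < g p} \<noteq> {})"
    if \<F>: "\<F> \<in> ?cih" for \<F> a
  proof
    assume a: "a < level X h \<F>"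
    show "\<forall>A\<in>e_G X \<F>. A \<inter> {p \<in> topspace ?b. a < g p} \<noteq> {}"
    proof
      fix A assume A: "A \<in> e_G X \<F>"
      then have Asub: "A \<subseteq> topspace ?b" by (simp add: mem_e_G_iff[OF \<F>] closedin_subset)
      show "A \<inter> {p \<in> topspace ?b. a < g p} \<noteq> {}"
      proof
        assume "A \<inter> {p \<in> topspace ?b. a < g p} = {}"
        then have "A \<subseteq> sublevel ?b g a" using Asub by (force simp: sublevel_def)
        then have "{x \<in> topspace X. beta_emb X x \<in> A} \<subseteq> sublevel X h a"
          unfolding sub[symmetric] by blast
        then have "sublevel X h a \<in> \<F>"
          using A cih_up[OF \<F>] closedin_sublevel[OF unit_valued_real[OF h]]
          unfolding mem_e_G_iff[OF \<F>] by blast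
        with a show False by (simp flip: level_le_iff[OF \<F> h])
      qed
    qed
  next
    assume "\<forall>A\<in>e_G X \<F>. A \<inter> {p \<in> topspace ?b. a < g p} \<noteq> {}"
    then have "sublevel ?b g a \<notin> e_G X \<F>" by (force simp: sublevel_def)
    then show "a < level X h \<F>" using in_e[OF \<F>] by force
  qed
  have open_lt: "openin ?b {p \<in> topspace ?b. g p < a}" and open_gt: "openin ?b {p \<in> topspace ?b. a < g p}" for a
    using gc by (simp_all add: continuous_map_upper_lower_semicontinuous_lt)
  have "{\<F> \<in> ?cih. level X h \<F> < a} =
      {\<F> \<in> ?cih. e_G X \<F> \<in> {\<G> \<in> inclusion_hyperspaces ?b. \<exists>A\<in>\<G>. A \<subseteq> {p \<in> topspace ?b. g p < a}}}" for a
    by (simp add: less e_G_in_inclusion_hyperspaces[OF X] cong: conj_cong)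
  then have lt: "openin (G_check X) {\<F> \<in> ?cih. level X h \<F> < a}" for a
    using openin_G_checkI[OF openin_G_space_subset[OF open_lt]] by simp
  have "{\<F> \<in> ?cih. a < level X h \<F>} =
      {\<F> \<in> ?cih. e_G X \<F> \<in> {\<G> \<in> inclusion_hyperspaces ?b. \<forall>A\<in>\<G>. A \<inter> {p \<in> topspace ?b. a < g p} \<noteq> {}}}" for a
    by (simp add: greater e_G_in_inclusion_hyperspaces[OF X] cong: conj_cong)
  then have gt: "openin (G_check X) {\<F> \<in> ?cih. a < level X h \<F>}" for a
    using openin_G_checkI[OF openin_G_space_meets[OF open_gt]] by simp
  show ?thesis
    using lt gt level_bounds[OF _ h]
    by (auto simp: continuous_map_in_subtopology continuous_map_upper_lower_semicontinuous_lt
        topspace_G_check[OF X])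
qed

text \<open>With \<open>unit_valued_level\<close>, this says that the topology of
  \<open>G_check X\<close> is the initial one for the level functions. The two kinds of subbasic
  sets are treated separately: for "some member inside U" a Urysohn function on the compactification
  supplies the level function, for "all members meet U" a function from
  \<open>separating_unit_valued\<close> does.\<close>

lemma continuous_map_into_G_check:
  assumes X: "tychonoff_space X"
    and cih: "\<And>z. z \<in> topspace Z \<Longrightarrow> g z \<in> compact_inclusion_hyperspaces X"
    and lev: "\<And>h. unit_valued X h \<Longrightarrow> continuous_map Z euclideanreal (\<lambda>z. level X h (g z))"
  shows "continuous_map Z (G_check X) g"
proof -
  let ?b = "beta_space X" and ?i = "beta_emb X"
  let ?S = "{{\<F> \<in> inclusion_hyperspaces ?b. \<exists>F\<in>\<F>. F \<subseteq> U} | U. openin ?b U} \<union>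
            {{\<F> \<in> inclusion_hyperspaces ?b. \<forall>F\<in>\<F>. F \<inter> U \<noteq> {}} | U. openin ?b U}"
  have e_G: "e_G X (g z) \<in> inclusion_hyperspaces ?b" if "z \<in> topspace Z" for z
    using e_G_in_inclusion_hyperspaces[OF X cih[OF that]] .
  have open_lt: "openin Z {z \<in> topspace Z. level X h (g z) < a}"
    and open_gt: "openin Z {z \<in> topspace Z. a < level X h (g z)}" if "unit_valued X h" for h a
    using lev[OF that] by (simp_all add: continuous_map_upper_lower_semicontinuous_lt)
  have "continuous_map Z (topology_generated_by ?S) (e_G X \<circ> g)"
  proof (rule continuous_on_generated_topo)
    have "topspace (G_space ?b) = \<Union>?S"
      unfolding G_space_def topology_generated_by_topspace ..
    then show "(e_G X \<circ> g) ` topspace Z \<subseteq> \<Union>?S"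
      using e_G by (auto simp: topspace_G_space)
    fix T assume "T \<in> ?S"
    then consider (sub) U where "openin ?b U" "T = {\<F> \<in> inclusion_hyperspaces ?b. \<exists>F\<in>\<F>. F \<subseteq> U}"
      | (meet) U where "openin ?b U" "T = {\<F> \<in> inclusion_hyperspaces ?b. \<forall>F\<in>\<F>. F \<inter> U \<noteq> {}}"
      by blast
    then show "openin Z ((e_G X \<circ> g) -` T \<inter> topspace Z)"
    proof cases
      case sub
      show ?thesis
      proof (subst openin_subopen, intro ballI)
        fix z assume "z \<in> (e_G X \<circ> g) -` T \<inter> topspace Z"
        then obtain A where z: "z \<in> topspace Z" and A: "A \<in> e_G X (g z)" "A \<subseteq> U"
          by (auto simp: sub)
        have Acl: "closedin ?b A" and Apre: "{x \<in> topspace X. ?i x \<in> A} \<in> g z"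
          using A(1) by (simp_all add: mem_e_G_iff[OF cih[OF z]])
        have "normal_space ?b"
          using compact_Hausdorff_or_regular_imp_normal_space compact_space_beta_space
            Hausdorff_space_beta_space by blast
        moreover have "closedin ?b (topspace ?b - U)" "disjnt A (topspace ?b - U)"
          using sub(1) A(2) by (auto simp: disjnt_def)
        ultimately obtain f where f: "unit_valued ?b f" "f ` A \<subseteq> {0}" "f ` (topspace ?b - U) \<subseteq> {1}"
          using Acl Urysohn_lemma[of ?b A "topspace ?b - U" 0 1] by auto
        have h: "unit_valued X (f \<circ> ?i)"
          using continuous_map_compose[OF continuous_map_beta_emb[OF X] f(1)] .
        \<comment> \<open>As f vanishes on A, the level at z is 0. Where the level is below 1, the
          sublevel set of f at that level belongs to \<open>e_G X (g w)\<close>, and it lies in U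
          because f is 1 outside U.\<close>
        let ?T = "{w \<in> topspace Z. level X (f \<circ> ?i) (g w) < 1}"
        have "level X (f \<circ> ?i) (g z) \<le> 0"
          using level_nonpos[OF cih[OF z] h Apre] f(2) by auto
        moreover have "w \<in> (e_G X \<circ> g) -` T" if w: "w \<in> ?T" for w
        proof -
          let ?a = "level X (f \<circ> ?i) (g w)"
          have wZ: "w \<in> topspace Z" "?a < 1" using w by auto
          have "sublevel X (f \<circ> ?i) ?a \<in> g w"
            using level_le_iff[OF cih[OF wZ(1)] h] by blast
          moreover have "{x \<in> topspace X. ?i x \<in> sublevel ?b f ?a} = sublevel X (f \<circ> ?i) ?a"
            using continuous_map_beta_emb[OF X] by (auto simp: sublevel_def continuous_map_def)
          ultimately have "sublevel ?b f ?a \<in> e_G X (g w)"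
            using closedin_sublevel[OF unit_valued_real[OF f(1)]]
            by (simp add: mem_e_G_iff[OF cih[OF wZ(1)]])
          moreover have "sublevel ?b f ?a \<subseteq> U"
            using f(3) wZ(2) by (fastforce simp: sublevel_def)
          ultimately show ?thesis
            using e_G[OF wZ(1)] by (auto simp: sub)
        qed
        ultimately show "\<exists>V. openin Z V \<and> z \<in> V \<and> V \<subseteq> (e_G X \<circ> g) -` T \<inter> topspace Z"
          using open_lt[OF h, of 1] z by (intro exI[of _ ?T]) auto
      qed
    next
      case meet
      let ?C = "{x \<in> topspace X. ?i x \<in> topspace ?b - U}"
      have ccl: "closedin ?b (topspace ?b - U)" using meet(1) by blast
      then have C: "closedin X ?C"
        by (rule closedin_continuous_map_preimage[OF continuous_map_beta_emb[OF X]])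
      \<comment> \<open>The complement of U is the largest closed set missing U, so by upward
        closure it is the only set to test.\<close>
      have iff: "e_G X (g w) \<in> T \<longleftrightarrow> ?C \<notin> g w" if w: "w \<in> topspace Z" for w
      proof -
        have "(\<forall>F\<in>e_G X (g w). F \<inter> U \<noteq> {}) \<longleftrightarrow> ?C \<notin> g w"
        proof
          assume "\<forall>F\<in>e_G X (g w). F \<inter> U \<noteq> {}"
          then have "topspace ?b - U \<notin> e_G X (g w)" by blast
          then show "?C \<notin> g w" using ccl by (simp add: mem_e_G_iff[OF cih[OF w]])
        next
          assume nC: "?C \<notin> g w"
          show "\<forall>F\<in>e_G X (g w). F \<inter> U \<noteq> {}"
          proof (intro ballI notI)
            fix F assume F: "F \<in> e_G X (g w)" "F \<inter> U = {}"
            then have "F \<subseteq> topspace ?b" "{x \<in> topspace X. ?i x \<in> F} \<in> g w"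
              by (simp_all add: mem_e_G_iff[OF cih[OF w]] closedin_subset)
            moreover from this(1) F(2) have "{x \<in> topspace X. ?i x \<in> F} \<subseteq> ?C" by auto
            ultimately show False using cih_up[OF cih[OF w] _ _ C] nC by blast
          qed
        qed
        then show ?thesis using e_G[OF w] by (simp add: meet)
      qed
      show ?thesis
      proof (subst openin_subopen, intro ballI)
        fix z assume z: "z \<in> (e_G X \<circ> g) -` T \<inter> topspace Z"
        then have "?C \<notin> g z" using iff by auto
        then obtain h where h: "unit_valued X h" "h ` ?C \<subseteq> {0}" "0 < level X h (g z)"
          using separating_unit_valued[OF X cih C] z by blast
        \<comment> \<open>Since h vanishes on \<open>?C\<close>, a positive level at w keeps
          \<open>?C\<close> out of \<open>g w\<close>.\<close>
        let ?T = "{w \<in> topspace Z. 0 < level X h (g w)}"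
        have "w \<in> (e_G X \<circ> g) -` T" if w: "w \<in> ?T" for w
          using w iff[of w] level_nonpos[OF cih h(1) _ h(2)] by force
        then show "\<exists>V. openin Z V \<and> z \<in> V \<and> V \<subseteq> (e_G X \<circ> g) -` T \<inter> topspace Z"
          using open_gt[OF h(1), of 0] h(3) z by (intro exI[of _ ?T]) auto
      qed
    qed
  qed
  then show ?thesis
    unfolding G_check_def G_space_def[symmetric]
    by (rule continuous_map_pullback') (use cih in auto)
qed

text \<open>The levels embed \<open>G_check X\<close> into a product of real lines. They separate
  points by \<open>separating_unit_valued\<close> and \<open>level_nonpos\<close>, and the inverse
  on the image is continuous because each level function composed with it is a coordinate
  projection.\<close>

lemma tychonoff_space_G_check:
  assumes X: "tychonoff_space X"
  shows "tychonoff_space (G_check X)"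
proof -
  let ?cih = "compact_inclusion_hyperspaces X"
  let ?P = "product_topology (\<lambda>_. euclideanreal) (unit_maps X)"
  define E where "E \<F> = (\<lambda>h\<in>unit_maps X. level X h \<F>)" for \<F>
  have unit: "unit_valued X h" if "h \<in> unit_maps X" for h
    using that by (simp add: unit_maps_def)
  have sub: "\<F> \<subseteq> \<G>" if \<F>: "\<F> \<in> ?cih" and \<G>: "\<G> \<in> ?cih" and eq: "E \<F> = E \<G>" for \<F> \<G>
  proof
    fix F assume F: "F \<in> \<F>"
    show "F \<in> \<G>"
    proof (rule ccontr)
      assume "F \<notin> \<G>"
      then obtain h where h: "unit_valued X h" "h ` F \<subseteq> {0}" "0 < level X h \<G>"
        using separating_unit_valued[OF X \<G> cih_closedin[OF \<F> F]] by blast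
      \<comment> \<open>The coordinates are indexed by \<open>unit_maps X\<close>, whose elements
        are \<open>undefined\<close> outside the space. Restricting h makes it an index and leaves
        its sublevel sets, hence its level, unchanged.\<close>
      let ?h = "restrict h (topspace X)"
      have "?h \<in> unit_maps X"
        using h(1) continuous_map_eq[of X _ h ?h] by (auto simp: unit_maps_def)
      then have "level X ?h \<F> = level X ?h \<G>"
        using eq by (metis E_def restrict_apply')
      moreover have "sublevel X ?h = sublevel X h" by (auto simp: sublevel_def fun_eq_iff)
      then have "level X ?h = level X h" by (simp add: level_def fun_eq_iff)
      ultimately show False
        using h(3) level_nonpos[OF \<F> h(1) F h(2)] by simp
    qed
  qed
  have inj: "inj_on E ?cih"
    by (rule inj_onI) (metis sub subset_antisym)
  have E_cont: "continuous_map (G_check X) ?P E"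
    using unit_valued_real[OF unit_valued_level[OF X unit]]
    by (auto simp: continuous_map_componentwise E_def)
  let ?R = "subtopology ?P (E ` ?cih)"
  have R: "topspace ?R = E ` ?cih"
    by (auto simp: E_def)
  have "continuous_map ?R (G_check X) (inv_into ?cih E)"
  proof (rule continuous_map_into_G_check[OF X])
    fix p assume "p \<in> topspace ?R"
    then show "inv_into ?cih E p \<in> ?cih" unfolding R by (rule inv_into_into)
  next
    fix h assume h: "unit_valued X h"
    let ?h = "restrict h (topspace X)"
    have mem: "?h \<in> unit_maps X"
      using h continuous_map_eq[of X _ h ?h] by (auto simp: unit_maps_def)
    have "sublevel X ?h = sublevel X h" by (auto simp: sublevel_def fun_eq_iff)
    then have eq: "level X ?h = level X h" by (simp add: level_def fun_eq_iff)
    have val: "level X h (inv_into ?cih E p) = p ?h" if "p \<in> topspace ?R" for p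
    proof -
      have "E (inv_into ?cih E p) = p" using that unfolding R by (rule f_inv_into_f)
      then have "p ?h = level X ?h (inv_into ?cih E p)" using mem by (metis E_def restrict_apply')
      then show ?thesis by (simp add: eq)
    qed
    have "continuous_map ?R euclideanreal (\<lambda>p. p ?h)"
      by (intro continuous_map_from_subtopology continuous_map_product_projection mem)
    then show "continuous_map ?R euclideanreal (\<lambda>p. level X h (inv_into ?cih E p))"
      by (rule continuous_map_eq) (simp only: val)
  qed
  then have "homeomorphic_maps (G_check X) ?R E (inv_into ?cih E)"
    using E_cont inj R
    by (auto simp: homeomorphic_maps_def continuous_map_in_subtopology topspace_G_check[OF X]
        f_inv_into_f)
  then have homeo: "G_check X homeomorphic_space ?R"
    unfolding homeomorphic_space_def by blast
  have "completely_regular_space ?R"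
    by (intro completely_regular_space_subtopology)
      (simp add: completely_regular_space_product_topology metrizable_imp_completely_regular_space
        metrizable_space_euclidean)
  moreover have "Hausdorff_space ?R"
    by (intro Hausdorff_space_subtopology) (simp add: Hausdorff_space_product_topology)
  ultimately show ?thesis
    using homeomorphic_completely_regular_space[OF homeo] homeomorphic_Hausdorff_space[OF homeo]
    by (simp add: tychonoff_space_def)
qed

section \<open>The monad structure\<close>

lemma mem_G_check_map_iff:
  assumes \<F>: "\<F> \<in> compact_inclusion_hyperspaces X" and f: "continuous_map X Y f"
  shows "B \<in> G_check_map Y f \<F> \<longleftrightarrow> closedin Y B \<and> {x \<in> topspace X. f x \<in> B} \<in> \<F>"
proof -
  have "(\<exists>F\<in>\<F>. f ` F \<subseteq> B) \<longleftrightarrow> {x \<in> topspace X. f x \<in> B} \<in> \<F>" if B: "closedin Y B"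
  proof
    assume "\<exists>F\<in>\<F>. f ` F \<subseteq> B"
    then obtain F where F: "F \<in> \<F>" "f ` F \<subseteq> B" by blast
    \<comment> \<open>The preimage of B is the largest closed set that f maps into B, so the
      existential reduces to membership of this one set.\<close>
    then have "F \<subseteq> {x \<in> topspace X. f x \<in> B}" using cih_subset[OF \<F> F(1)] by blast
    then show "{x \<in> topspace X. f x \<in> B} \<in> \<F>"
      using cih_up[OF \<F> F(1)] closedin_continuous_map_preimage[OF f B] by blast
  qed (intro bexI[of _ "{x \<in> topspace X. f x \<in> B}"], auto)
  then show ?thesis by (auto simp: G_check_map_def)
qed

text \<open>Common core of two constructions: p is the preimage under a continuous map for the
  functor, and \<open>containing X\<close> for the multiplication. One inclusion for directed
  intersections suffices, since upward closure passes from \<open>\<Inter>\<close> of the images to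
  the larger set.\<close>

lemma preimage_in_cih:
  assumes pre: "\<And>B. closedin Y B \<Longrightarrow> closedin X (p B)" "p {} = {}" "p (topspace Y) = topspace X"
    and mono: "\<And>A B. \<lbrakk>closedin Y B; A \<subseteq> B\<rbrakk> \<Longrightarrow> p A \<subseteq> p B"
    and Inter: "\<And>\<C>. \<lbrakk>down_directed \<C>; \<And>C. C \<in> \<C> \<Longrightarrow> closedin Y C\<rbrakk> \<Longrightarrow> \<Inter>(p ` \<C>) \<subseteq> p (\<Inter>\<C>)"
    and \<F>: "\<F> \<in> compact_inclusion_hyperspaces X"
  shows "{B. closedin Y B \<and> p B \<in> \<F>} \<in> compact_inclusion_hyperspaces Y"
  unfolding compact_inclusion_hyperspaces_iff
proof (intro conjI allI impI)
  show "{B. closedin Y B \<and> p B \<in> \<F>} \<noteq> {}"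
    using cih_topspace[OF \<F>] pre(3) by (metis (mono_tags) closedin_topspace empty_Collect_eq)
  show "{B. closedin Y B \<and> p B \<in> \<F>} \<subseteq> exp_space Y"
    using cih_nonempty[OF \<F>] pre(2) by (auto simp: exp_space_def)
  show "up_closed_in Y {B. closedin Y B \<and> p B \<in> \<F>}"
    unfolding up_closed_in_def using cih_up[OF \<F>] pre(1) mono by blast
next
  fix \<C> assume \<C>: "down_directed \<C> \<and> \<C> \<subseteq> {B. closedin Y B \<and> p B \<in> \<F>}"
  have "closedin Y (\<Inter>\<C>)"
    using \<C> by (intro closedin_Inter) (auto simp: down_directed_def)
  have "down_directed (p ` \<C>)"
    unfolding down_directed_def
  proof (intro conjI ballI)
    show "p ` \<C> \<noteq> {}" using \<C> by (simp add: down_directed_def)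
    fix A B assume "A \<in> p ` \<C>" "B \<in> p ` \<C>"
    then obtain A' B' where AB: "A' \<in> \<C>" "B' \<in> \<C>" "A = p A'" "B = p B'" by blast
    then obtain C where C: "C \<in> \<C>" "C \<subseteq> A'" "C \<subseteq> B'"
      using \<C> unfolding down_directed_def by (metis le_inf_iff)
    have "closedin Y A'" "closedin Y B'" using \<C> AB(1,2) by blast+
    then have "p C \<subseteq> A \<inter> B" using mono C(2,3) by (simp add: AB)
    then show "\<exists>C\<in>p ` \<C>. C \<subseteq> A \<inter> B" using C(1) by blast
  qed
  then have "\<Inter>(p ` \<C>) \<in> \<F>" using cih_Inter[OF \<F>] \<C> by blast
  moreover have "\<Inter>(p ` \<C>) \<subseteq> p (\<Inter>\<C>)" using Inter \<C> by blast
  ultimately have "p (\<Inter>\<C>) \<in> \<F>"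
    using cih_up[OF \<F>] pre(1)[OF \<open>closedin Y (\<Inter>\<C>)\<close>] by blast
  with \<open>closedin Y (\<Inter>\<C>)\<close> show "\<Inter>\<C> \<in> {B. closedin Y B \<and> p B \<in> \<F>}" by simp
qed

text \<open>\<open>level_le_iff\<close> describes a level through its upper bounds only; this turns
  such descriptions into equations between levels.\<close>

lemma eq_if_same_upper_bounds:
  fixes x y :: "'a::order"
  assumes "\<And>a. x \<le> a \<longleftrightarrow> y \<le> a"
  shows "x = y"
  using assms by (metis order.antisym order.refl)

lemma G_check_map_in_cih:
  assumes \<F>: "\<F> \<in> compact_inclusion_hyperspaces X" and f: "continuous_map X Y f"
  shows "G_check_map Y f \<F> \<in> compact_inclusion_hyperspaces Y"
proof -
  have "G_check_map Y f \<F> = {B. closedin Y B \<and> {x \<in> topspace X. f x \<in> B} \<in> \<F>}"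
    using mem_G_check_map_iff[OF \<F> f] by blast
  also have "\<dots> \<in> compact_inclusion_hyperspaces Y"
    using f \<F> closedin_continuous_map_preimage[OF f]
    by (intro preimage_in_cih[where X = X]) (auto simp: continuous_map_def down_directed_def)
  finally show ?thesis .
qed

text \<open>The preimage under f of a sublevel set of h is the sublevel set of
  \<open>h \<circ> f\<close> at the same value.\<close>

lemma level_G_check_map:
  assumes \<F>: "\<F> \<in> compact_inclusion_hyperspaces X" and f: "continuous_map X Y f"
    and h: "unit_valued Y h"
  shows "level Y h (G_check_map Y f \<F>) = level X (h \<circ> f) \<F>"
proof (rule eq_if_same_upper_bounds)
  fix a
  have "{x \<in> topspace X. f x \<in> sublevel Y h a} = sublevel X (h \<circ> f) a"
    using f by (auto simp: sublevel_def continuous_map_def)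
  then show "level Y h (G_check_map Y f \<F>) \<le> a \<longleftrightarrow> level X (h \<circ> f) \<F> \<le> a"
    using closedin_sublevel[OF unit_valued_real[OF h]]
    by (simp add: level_le_iff[OF G_check_map_in_cih[OF \<F> f] h] mem_G_check_map_iff[OF \<F> f]
        level_le_iff[OF \<F> continuous_map_compose[OF f h]])
qed

lemma continuous_map_G_check_map:
  assumes X: "tychonoff_space X" and Y: "tychonoff_space Y" and f: "continuous_map X Y f"
  shows "continuous_map (G_check X) (G_check Y) (G_check_map Y f)"
proof (rule continuous_map_into_G_check[OF Y])
  show "G_check_map Y f \<F> \<in> compact_inclusion_hyperspaces Y" if "\<F> \<in> topspace (G_check X)" for \<F>
    using that G_check_map_in_cih[OF _ f] by (simp add: topspace_G_check[OF X])
  fix h assume h: "unit_valued Y h"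
  have "continuous_map (G_check X) euclideanreal (level X (h \<circ> f))"
    by (intro unit_valued_real unit_valued_level X continuous_map_compose[OF f h])
  then show "continuous_map (G_check X) euclideanreal (\<lambda>\<F>. level Y h (G_check_map Y f \<F>))"
    by (rule continuous_map_eq) (simp add: level_G_check_map[OF _ f h] topspace_G_check[OF X])
qed

lemma G_check_map_id:
  assumes \<F>: "\<F> \<in> compact_inclusion_hyperspaces X"
  shows "G_check_map X id \<F> = \<F>"
proof -
  have "{x \<in> topspace X. id x \<in> B} = B" if "closedin X B" for B
    using closedin_subset[OF that] by auto
  then show ?thesis
    using cih_closedin[OF \<F>] by (auto simp: mem_G_check_map_iff[OF \<F> continuous_map_id])
qed

text \<open>Membership of a closed B is decided by its preimage, and the preimage under
  \<open>g \<circ> f\<close> is taken in two steps.\<close>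

lemma G_check_map_comp:
  assumes \<F>: "\<F> \<in> compact_inclusion_hyperspaces X"
    and f: "continuous_map X Y f" and g: "continuous_map Y Z g"
  shows "G_check_map Z (g \<circ> f) \<F> = G_check_map Z g (G_check_map Y f \<F>)"
proof -
  have "{x \<in> topspace X. f x \<in> {y \<in> topspace Y. g y \<in> B}} = {x \<in> topspace X. (g \<circ> f) x \<in> B}" for B
    using f by (auto simp: continuous_map_def)
  then show ?thesis
    using closedin_continuous_map_preimage[OF g]
    by (auto simp: mem_G_check_map_iff[OF \<F> continuous_map_compose[OF f g]]
        mem_G_check_map_iff[OF G_check_map_in_cih[OF \<F> f] g] mem_G_check_map_iff[OF \<F> f])
qed

section \<open>The unit and its naturality\<close>

lemma eta_G_in_cih:
  assumes "x \<in> topspace X"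
  shows "eta_G X x \<in> compact_inclusion_hyperspaces X"
  unfolding compact_inclusion_hyperspaces_iff
proof (intro conjI allI impI)
  show "eta_G X x \<noteq> {}"
    using assms closedin_topspace[of X] by (auto simp: eta_G_def exp_space_def)
  show "eta_G X x \<subseteq> exp_space X" by (auto simp: eta_G_def)
  show "up_closed_in X (eta_G X x)" by (auto simp: up_closed_in_def eta_G_def exp_space_def)
  fix \<C> assume \<C>: "down_directed \<C> \<and> \<C> \<subseteq> eta_G X x"
  then have "closedin X (\<Inter>\<C>)"
    by (intro closedin_Inter) (auto simp: down_directed_def eta_G_def exp_space_def)
  with \<C> show "\<Inter>\<C> \<in> eta_G X x" by (auto simp: eta_G_def exp_space_def)
qed

lemma level_eta_G:
  assumes x: "x \<in> topspace X" and h: "unit_valued X h"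
  shows "level X h (eta_G X x) = h x"
proof (rule eq_if_same_upper_bounds)
  show "level X h (eta_G X x) \<le> a \<longleftrightarrow> h x \<le> a" for a
    using closedin_sublevel[OF unit_valued_real[OF h], of a] x
    unfolding level_le_iff[OF eta_G_in_cih[OF x] h]
    by (auto simp: eta_G_def exp_space_def sublevel_def)
qed

lemma continuous_map_eta_G:
  assumes X: "tychonoff_space X"
  shows "continuous_map X (G_check X) (eta_G X)"
proof (rule continuous_map_into_G_check[OF X eta_G_in_cih])
  show "continuous_map X euclideanreal (\<lambda>x. level X h (eta_G X x))" if "unit_valued X h" for h
    using unit_valued_real[OF that]
    by (rule continuous_map_eq) (simp add: level_eta_G that)
qed

text \<open>Both sides consist of the closed B with \<open>f x \<in> B\<close>.\<close>

lemma eta_G_natural: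
  assumes x: "x \<in> topspace X" and f: "continuous_map X Y f"
  shows "eta_G Y (f x) = G_check_map Y f (eta_G X x)"
proof (rule set_eqI)
  fix B
  have "B \<in> G_check_map Y f (eta_G X x) \<longleftrightarrow> closedin Y B \<and> f x \<in> B"
    using x closedin_continuous_map_preimage[OF f, of B]
    unfolding mem_G_check_map_iff[OF eta_G_in_cih[OF x] f]
    by (auto simp: eta_G_def exp_space_def)
  then show "B \<in> eta_G Y (f x) \<longleftrightarrow> B \<in> G_check_map Y f (eta_G X x)"
    by (auto simp: eta_G_def exp_space_def)
qed

section \<open>The multiplication and its naturality\<close>

definition containing :: "'a topology \<Rightarrow> 'a set \<Rightarrow> 'a set set set" where
  "containing X F = {\<F> \<in> compact_inclusion_hyperspaces X. F \<in> \<F>}"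

text \<open>Membership of F in \<F> means that all h vanishing on F have level at most 0, so the set
  is an intersection of sublevel sets of continuous level functions.\<close>

lemma closedin_containing:
  assumes X: "tychonoff_space X" and F: "closedin X F"
  shows "closedin (G_check X) (containing X F)"
proof -
  let ?cih = "compact_inclusion_hyperspaces X"
  define H where "H = {h. unit_valued X h \<and> h ` F \<subseteq> {0}}"
  \<comment> \<open>Guarantees a nonempty index set; otherwise the intersection would be
    \<open>UNIV\<close>.\<close>
  have "(\<lambda>_. 0) \<in> H" by (auto simp: H_def)
  have "\<F> \<in> containing X F \<longleftrightarrow> \<F> \<in> (\<Inter>h\<in>H. sublevel (G_check X) (level X h) 0)" for \<F>
  proof (cases "\<F> \<in> ?cih")
    case True
    have "F \<in> \<F> \<longleftrightarrow> (\<forall>h\<in>H. level X h \<F> \<le> 0)"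
    proof
      show "\<forall>h\<in>H. level X h \<F> \<le> 0" if "F \<in> \<F>"
        using level_nonpos[OF True _ that] by (simp add: H_def)
      show "F \<in> \<F>" if "\<forall>h\<in>H. level X h \<F> \<le> 0"
      proof (rule ccontr)
        assume "F \<notin> \<F>"
        then show False
          using separating_unit_valued[OF X True F] that unfolding H_def
          by (metis (mono_tags, lifting) linorder_not_le mem_Collect_eq)
      qed
    qed
    then show ?thesis using True by (simp add: containing_def sublevel_def topspace_G_check[OF X])
  next
    case False
    then show ?thesis
      using \<open>(\<lambda>_. 0) \<in> H\<close> by (auto simp: containing_def sublevel_def topspace_G_check[OF X])
  qed
  then have "containing X F = (\<Inter>h\<in>H. sublevel (G_check X) (level X h) 0)" by blast
  also have "closedin (G_check X) \<dots>"
  proof (rule closedin_INT)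
    show "H \<noteq> {}" using \<open>(\<lambda>_. 0) \<in> H\<close> by blast
    show "closedin (G_check X) (sublevel (G_check X) (level X h) 0)" if "h \<in> H" for h
      using that by (intro closedin_sublevel unit_valued_real unit_valued_level X) (simp add: H_def)
  qed
  finally show ?thesis .
qed

context
  fixes X :: "'a topology" and \<FF> :: "'a set set set set"
  assumes X: "tychonoff_space X" and \<FF>: "\<FF> \<in> compact_inclusion_hyperspaces (G_check X)"
begin

text \<open>\<open>containing X F\<close> is closed and is the largest H with
  \<open>F \<in> \<Inter>H\<close>, so by upward closure of \<FF> it is a witness whenever there is
  one.\<close>

lemma mem_mu_G_iff: "F \<in> mu_G X \<FF> \<longleftrightarrow> closedin X F \<and> containing X F \<in> \<FF>"
proof
  assume "F \<in> mu_G X \<FF>"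
  then obtain H where F: "closedin X F" and H: "H \<in> \<FF>" "F \<in> \<Inter>H"
    by (auto simp: mu_G_def exp_space_def)
  have "H \<subseteq> containing X F"
    using H cih_subset[OF \<FF> H(1)] by (auto simp: containing_def topspace_G_check[OF X])
  then show "closedin X F \<and> containing X F \<in> \<FF>"
    using F cih_up[OF \<FF> H(1)] closedin_containing[OF X F] by blast
next
  assume F: "closedin X F \<and> containing X F \<in> \<FF>"
  \<comment> \<open>Yields that F is nonempty, as \<open>exp_space\<close> demands: \<FF> does not
    contain the empty set.\<close>
  have "containing X {} = {}" using cih_nonempty by (auto simp: containing_def)
  with F have "F \<noteq> {}" using cih_nonempty[OF \<FF>] by metis
  with F show "F \<in> mu_G X \<FF>"
    by (auto simp: mu_G_def exp_space_def containing_def intro!: bexI[of _ "containing X F"])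
qed

lemma mu_G_in_cih: "mu_G X \<FF> \<in> compact_inclusion_hyperspaces X"
proof -
  have "mu_G X \<FF> = {F. closedin X F \<and> containing X F \<in> \<FF>}"
    using mem_mu_G_iff by blast
  also have "\<dots> \<in> compact_inclusion_hyperspaces X"
  proof (rule preimage_in_cih[where p = "containing X", OF _ _ _ _ _ \<FF>])
    show "closedin (G_check X) (containing X B)" if "closedin X B" for B
      using closedin_containing[OF X that] .
    show "containing X {} = {}" using cih_nonempty by (auto simp: containing_def)
    show "containing X (topspace X) = topspace (G_check X)"
      using cih_topspace by (auto simp: containing_def topspace_G_check[OF X])
  next
    fix A B assume "closedin X B" "A \<subseteq> B"
    then show "containing X A \<subseteq> containing X B"
      using cih_up[of _ X A B] by (auto simp: containing_def)
  next
    \<comment> \<open>Here compactness of the individual \<F> enters: an \<F> that contains every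
      set of \<C> also contains their intersection.\<close>
    fix \<C> assume \<C>: "down_directed \<C>" "\<And>C. C \<in> \<C> \<Longrightarrow> closedin X C"
    show "\<Inter>(containing X ` \<C>) \<subseteq> containing X (\<Inter>\<C>)"
    proof
      fix \<F> assume \<F>: "\<F> \<in> \<Inter>(containing X ` \<C>)"
      then have "\<F> \<in> compact_inclusion_hyperspaces X" "\<C> \<subseteq> \<F>"
        using \<C>(1) by (auto simp: containing_def down_directed_def)
      then show "\<F> \<in> containing X (\<Inter>\<C>)"
        using cih_Inter[of \<F> X \<C>] \<C>(1) by (simp add: containing_def)
    qed
  qed
  finally show ?thesis .
qed

text \<open>By \<open>level_le_iff\<close>, the hyperspaces containing a sublevel set of h form the
  sublevel set of \<open>level X h\<close> at the same value.\<close>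

lemma level_mu_G:
  assumes h: "unit_valued X h"
  shows "level X h (mu_G X \<FF>) = level (G_check X) (level X h) \<FF>"
proof (rule eq_if_same_upper_bounds)
  fix a
  have "containing X (sublevel X h a) = sublevel (G_check X) (level X h) a"
    using level_le_iff[OF _ h]
    by (auto simp: containing_def sublevel_def[of "G_check X"] topspace_G_check[OF X])
  then show "level X h (mu_G X \<FF>) \<le> a \<longleftrightarrow> level (G_check X) (level X h) \<FF> \<le> a"
    using closedin_sublevel[OF unit_valued_real[OF h]]
    by (simp add: level_le_iff[OF mu_G_in_cih h] mem_mu_G_iff
        level_le_iff[OF \<FF> unit_valued_level[OF X h]])
qed

end

lemma continuous_map_mu_G:
  assumes X: "tychonoff_space X"
  shows "continuous_map (G_check (G_check X)) (G_check X) (mu_G X)"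
proof (rule continuous_map_into_G_check[OF X])
  note top = topspace_G_check[OF tychonoff_space_G_check[OF X]]
  show "mu_G X \<FF> \<in> compact_inclusion_hyperspaces X" if "\<FF> \<in> topspace (G_check (G_check X))" for \<FF>
    using that mu_G_in_cih[OF X] by (simp add: top)
  fix h assume h: "unit_valued X h"
  have "continuous_map (G_check (G_check X)) euclideanreal (level (G_check X) (level X h))"
    by (intro unit_valued_real unit_valued_level tychonoff_space_G_check X h)
  then show "continuous_map (G_check (G_check X)) euclideanreal (\<lambda>\<FF>. level X h (mu_G X \<FF>))"
    by (rule continuous_map_eq) (simp add: level_mu_G[OF X _ h] top)
qed

text \<open>The preimage of \<open>containing Y B\<close> under the induced map is
  \<open>containing X\<close> of the preimage of B under f; both sides test whether this set is in
  \<FF>.\<close>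

lemma mu_G_natural:
  assumes X: "tychonoff_space X" and Y: "tychonoff_space Y" and f: "continuous_map X Y f"
    and \<FF>: "\<FF> \<in> compact_inclusion_hyperspaces (G_check X)"
  shows "mu_G Y (G_check_map (G_check Y) (G_check_map Y f) \<FF>) = G_check_map Y f (mu_G X \<FF>)"
proof (rule set_eqI)
  fix B
  note Gf = continuous_map_G_check_map[OF X Y f]
  have "{\<F> \<in> topspace (G_check X). G_check_map Y f \<F> \<in> containing Y B} =
      containing X {x \<in> topspace X. f x \<in> B}" if "closedin Y B"
    using that G_check_map_in_cih[OF _ f]
    by (auto simp: containing_def topspace_G_check[OF X] mem_G_check_map_iff[OF _ f])
  then show "B \<in> mu_G Y (G_check_map (G_check Y) (G_check_map Y f) \<FF>) \<longleftrightarrow>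
      B \<in> G_check_map Y f (mu_G X \<FF>)"
    using closedin_containing[OF Y, of B] closedin_continuous_map_preimage[OF f, of B]
    by (auto simp: mem_mu_G_iff[OF Y G_check_map_in_cih[OF \<FF> Gf]] mem_G_check_map_iff[OF \<FF> Gf]
        mem_G_check_map_iff[OF mu_G_in_cih[OF X \<FF>] f] mem_mu_G_iff[OF X \<FF>])
qed

section \<open>Unit laws and associativity\<close>

lemma mu_G_eta_G:
  assumes X: "tychonoff_space X" and \<F>: "\<F> \<in> compact_inclusion_hyperspaces X"
  shows "mu_G X (eta_G (G_check X) \<F>) = \<F>"
proof (rule set_eqI)
  fix F
  have \<F>': "\<F> \<in> topspace (G_check X)" using \<F> by (simp add: topspace_G_check[OF X])
  \<comment> \<open>The left side says that \<F> is a point of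
    \<open>containing X F\<close>.\<close>
  show "F \<in> mu_G X (eta_G (G_check X) \<F>) \<longleftrightarrow> F \<in> \<F>"
    using \<F> cih_closedin[OF \<F>, of F] closedin_containing[OF X, of F]
    unfolding mem_mu_G_iff[OF X eta_G_in_cih[OF \<F>']]
    by (auto simp: eta_G_def exp_space_def containing_def)
qed

text \<open>For closed F the preimage of \<open>containing X F\<close> under the unit is F
  itself.\<close>

lemma mu_G_map_eta_G:
  assumes X: "tychonoff_space X" and \<F>: "\<F> \<in> compact_inclusion_hyperspaces X"
  shows "mu_G X (G_check_map (G_check X) (eta_G X) \<F>) = \<F>"
proof (rule set_eqI)
  fix F
  note eta = continuous_map_eta_G[OF X]
  have "eta_G X x \<in> containing X F \<longleftrightarrow> x \<in> F" if "closedin X F" "x \<in> topspace X" for x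
    using that eta_G_in_cih[OF that(2)] unfolding containing_def by (auto simp: eta_G_def exp_space_def)
  then have "{x \<in> topspace X. eta_G X x \<in> containing X F} = F" if "closedin X F"
    using that closedin_subset[OF that] by auto
  then show "F \<in> mu_G X (G_check_map (G_check X) (eta_G X) \<F>) \<longleftrightarrow> F \<in> \<F>"
    using cih_closedin[OF \<F>, of F] closedin_containing[OF X, of F]
    by (auto simp: mem_mu_G_iff[OF X G_check_map_in_cih[OF \<F> eta]] mem_G_check_map_iff[OF \<F> eta])
qed

text \<open>The preimage of \<open>containing X F\<close> under the multiplication is
  \<open>containing\<close> applied twice to F, so for closed F both sides test whether this one set
  belongs to \<Theta>.\<close>

lemma mu_G_assoc:
  assumes X: "tychonoff_space X"
    and \<Theta>: "\<Theta> \<in> compact_inclusion_hyperspaces (G_check (G_check X))"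
  shows "mu_G X (G_check_map (G_check X) (mu_G X) \<Theta>) = mu_G X (mu_G (G_check X) \<Theta>)"
proof (rule set_eqI)
  fix F
  note GX = tychonoff_space_G_check[OF X]
  note mu = continuous_map_mu_G[OF X]
  have "{\<FF> \<in> topspace (G_check (G_check X)). mu_G X \<FF> \<in> containing X F} =
      containing (G_check X) (containing X F)" if "closedin X F"
    using that mu_G_in_cih[OF X]
    by (auto simp: containing_def[of X] containing_def[of "G_check X"] topspace_G_check[OF GX]
        mem_mu_G_iff[OF X])
  then show "F \<in> mu_G X (G_check_map (G_check X) (mu_G X) \<Theta>) \<longleftrightarrow>
      F \<in> mu_G X (mu_G (G_check X) \<Theta>)"
    using closedin_containing[OF X, of F]
    by (auto simp: mem_mu_G_iff[OF X G_check_map_in_cih[OF \<Theta> mu]] mem_G_check_map_iff[OF \<Theta> mu]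
        mem_mu_G_iff[OF X mu_G_in_cih[OF GX \<Theta>]] mem_mu_G_iff[OF GX \<Theta>])
qed

theorem theorem2p10:
  shows
    "\<comment> \<open>\<open>G_check\<close> is a functor on the category of Tychonoff spaces\<close>
    (\<forall>X::'a topology. tychonoff_space X \<longrightarrow> tychonoff_space (G_check X))
    \<and> (\<forall>(X::'a topology) (Y::'b topology) f.
      tychonoff_space X \<and> tychonoff_space Y \<and> continuous_map X Y f \<longrightarrow>
      continuous_map (G_check X) (G_check Y) (G_check_map Y f))
    \<and> (\<forall>X::'a topology. tychonoff_space X \<longrightarrow>
      (\<forall>\<F>\<in>topspace (G_check X). G_check_map X id \<F> = \<F>))
    \<and> (\<forall>(X::'a topology) (Y::'b topology) (Z::'c topology) f g.
      tychonoff_space X \<and> tychonoff_space Y \<and> tychonoff_space Z \<and>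
      continuous_map X Y f \<and> continuous_map Y Z g \<longrightarrow>
      (\<forall>\<F>\<in>topspace (G_check X).
         G_check_map Z (g \<circ> f) \<F> = G_check_map Z g (G_check_map Y f \<F>)))
    \<and> \<comment> \<open>\<open>eta_G\<close> is a natural transformation\<close>
    (\<forall>X::'a topology. tychonoff_space X \<longrightarrow> continuous_map X (G_check X) (eta_G X))
    \<and> (\<forall>(X::'a topology) (Y::'b topology) f.
      tychonoff_space X \<and> tychonoff_space Y \<and> continuous_map X Y f \<longrightarrow>
      (\<forall>x\<in>topspace X. eta_G Y (f x) = G_check_map Y f (eta_G X x)))
    \<and> \<comment> \<open>\<open>mu_G\<close> is a natural transformation\<close>
    (\<forall>X::'a topology. tychonoff_space X \<longrightarrow>
      continuous_map (G_check (G_check X)) (G_check X) (mu_G X))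
    \<and> (\<forall>(X::'a topology) (Y::'b topology) f.
      tychonoff_space X \<and> tychonoff_space Y \<and> continuous_map X Y f \<longrightarrow>
      (\<forall>\<FF>\<in>topspace (G_check (G_check X)).
         mu_G Y (G_check_map (G_check Y) (G_check_map Y f) \<FF>) = G_check_map Y f (mu_G X \<FF>)))
    \<and> \<comment> \<open>unit laws\<close>
    (\<forall>X::'a topology. tychonoff_space X \<longrightarrow>
      (\<forall>\<F>\<in>topspace (G_check X). mu_G X (eta_G (G_check X) \<F>) = \<F>))
    \<and> (\<forall>X::'a topology. tychonoff_space X \<longrightarrow>
      (\<forall>\<F>\<in>topspace (G_check X). mu_G X (G_check_map (G_check X) (eta_G X) \<F>) = \<F>))
    \<and> \<comment> \<open>associativity\<close>
    (\<forall>X::'a topology. tychonoff_space X \<longrightarrow>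
      (\<forall>\<Theta>\<in>topspace (G_check (G_check (G_check X))).
         mu_G X (G_check_map (G_check X) (mu_G X) \<Theta>) = mu_G X (mu_G (G_check X) \<Theta>)))"
  by (intro conjI allI impI ballI; (elim conjE)?)
    (simp_all add: topspace_G_check tychonoff_space_G_check continuous_map_G_check_map G_check_map_id
      G_check_map_comp continuous_map_eta_G eta_G_natural continuous_map_mu_G mu_G_natural
      mu_G_eta_G mu_G_map_eta_G mu_G_assoc)

end
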